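(* Let $\alpha,\mu$ be real numbers with $0<\mu\le 1$ and $\alpha+\mu\ge 0$, and let $\beta,\gamma,\delta$ be complex numbers with $\beta\neq 0$. Let $q\in\mathcal{R}(\alpha,\beta,\gamma,\delta,\mu)$ be analytic and univalent in $\mathbb{D}$. Set $$R(z):=\frac{zq'(z)}{\beta q(z)+\gamma}\quad (z\in\mathbb{D}).$$ Assume that $$\operatorname{Re}\left((\beta q(z)+\gamma)\left(1+\frac{\alpha}{\mu}+\frac{\alpha\delta}{\mu q(z)}\right)\right)>0\quad(z\in\mathbb{D})$$ and $$\operatorname{Re}\left(\frac{\alpha}{\mu}\frac{zq'(z)}{q(z)}+\frac{zR'(z)}{R(z)}\right)>0\quad(z\in\mathbb{D}).$$ If $p\in\mathcal{R}(\alpha,\beta,\gamma,\delta,\mu)$ satisfies $$(p(z))^\alpha\left(p(z)+\delta+\frac{zp'(z)}{\beta p(z)+\gamma}\right)^\mu\prec(q(z))^\alpha\left(q(z)+\delta+\frac{zq'(z)}{\beta q(z)+\gamma}\right)^\mu,$$ then $p(z)\prec q(z)$, and $q$ is the best dominant of this differential subordination.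
   Context: $\mathbb{D}=\{z\in\mathbb{C}:|z|<1\}$. Univalent means analytic and injective. For $f,g$ analytic in $\mathbb{D}$, $f\prec g$ ($f$ is subordinate to $g$) means there is an analytic $w:\mathbb{D}\to\mathbb{D}$ with $w(0)=0$ and $f(z)=g(w(z))$ for all $z\in\mathbb{D}$. The class $\mathcal{R}(\alpha,\beta,\gamma,\delta,\mu)$ consists of the analytic functions $p$ in $\mathbb{D}$ with $p(0)=1$, $p(z)\ne 0$ in $\mathbb{D}$, such that $P(z):=(p(z))^\alpha\left(p(z)+\delta+\frac{zp'(z)}{\beta p(z)+\gamma}\right)^\mu$ is well-defined in $\mathbb{D}$, the powers being principal values; that is, $\beta p(z)+\gamma$ has no zeros in $\mathbb{D}$ and the two principal powers appearing in $P$ are analytic functions in $\mathbb{D}$. The function $zR'(z)/R(z)$ is understood at $z=0$ by its removable-singularity value. A univalent function $\tilde q$ is a dominant of the differential subordination if $p\prec\tilde q$ for every $p\in\mathcal{R}(\alpha,\beta,\gamma,\delta,\mu)$ satisfying it; the best dominant is a dominant $q$ such that $q\prec\tilde q$ for every dominant $\tilde q$. *)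

theory Defs
  imports "HOL-Complex_Analysis.Complex_Analysis"
begin

abbreviation unit_disc :: "complex set" (\<open>\<D>\<close>) where
  "\<D> \<equiv> ball 0 1"

definition univalent :: "(complex \<Rightarrow> complex) \<Rightarrow> bool" where
  "univalent f \<longleftrightarrow> f holomorphic_on \<D> \<and> inj_on f \<D>"

definition subordinate :: "(complex \<Rightarrow> complex) \<Rightarrow> (complex \<Rightarrow> complex) \<Rightarrow> bool"
    (infix \<open>\<prec>\<close> 50) where
  "f \<prec> g \<longleftrightarrow>
     (\<exists>w. w holomorphic_on \<D> \<and> w ` \<D> \<subseteq> \<D> \<and> w 0 = 0 \<and> (\<forall>z\<in>\<D>. f z = g (w z)))"

text \<open>The Briot--Bouquet quotient \<open>z p'(z) / (\<beta> p(z) + \<gamma>)\<close>; for \<open>p = q\<close> it is \<open>R\<close>.\<close>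

definition BB_quot :: "complex \<Rightarrow> complex \<Rightarrow> (complex \<Rightarrow> complex) \<Rightarrow> complex \<Rightarrow> complex" where
  "BB_quot \<beta> \<gamma> p z = z * deriv p z / (\<beta> * p z + \<gamma>)"

text \<open>
  The complex \<open>powr\<close> is the principal power. Its convention \<open>0 powr \<mu> = 0\<close> is the usual one
  for \<open>\<mu> > 0\<close>; it is needed since the base of the second power may vanish (e.g. if \<open>\<mu> = 1\<close>).
\<close>

definition BB_expr ::
  "real \<Rightarrow> complex \<Rightarrow> complex \<Rightarrow> complex \<Rightarrow> real \<Rightarrow> (complex \<Rightarrow> complex) \<Rightarrow> complex \<Rightarrow> complex" where
  "BB_expr \<alpha> \<beta> \<gamma> \<delta> \<mu> p z =
     p z powr of_real \<alpha> * (p z + \<delta> + BB_quot \<beta> \<gamma> p z) powr of_real \<mu>"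

definition class_R ::
  "real \<Rightarrow> complex \<Rightarrow> complex \<Rightarrow> complex \<Rightarrow> real \<Rightarrow> (complex \<Rightarrow> complex) set" where
  "class_R \<alpha> \<beta> \<gamma> \<delta> \<mu> =
     {p. p holomorphic_on \<D> \<and> p 0 = 1 \<and> (\<forall>z\<in>\<D>. p z \<noteq> 0) \<and>
         (\<forall>z\<in>\<D>. \<beta> * p z + \<gamma> \<noteq> 0) \<and>
         (\<lambda>z. p z powr of_real \<alpha>) holomorphic_on \<D> \<and>
         (\<lambda>z. (p z + \<delta> + BB_quot \<beta> \<gamma> p z) powr of_real \<mu>) holomorphic_on \<D>}"

text \<open>
  \<open>z f'(z) / f(z)\<close>, with the value at \<open>z = 0\<close> given by the removable singularity
  (where the bare quotient would be \<open>0 / f 0 = 0\<close>).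
\<close>

definition log_deriv_quot :: "(complex \<Rightarrow> complex) \<Rightarrow> complex \<Rightarrow> complex" where
  "log_deriv_quot f z =
     (if z = 0 then remove_sings (\<lambda>x. x * deriv f x / f x) 0 else z * deriv f z / f z)"

text \<open>
  Dominants of the differential subordination \<open>BB_expr \<alpha> \<beta> \<gamma> \<delta> \<mu> p \<prec> h\<close> in the unknown \<open>p\<close>.
\<close>

definition dominant ::
  "real \<Rightarrow> complex \<Rightarrow> complex \<Rightarrow> complex \<Rightarrow> real \<Rightarrow> (complex \<Rightarrow> complex) \<Rightarrow> (complex \<Rightarrow> complex) \<Rightarrow> bool"
where
  "dominant \<alpha> \<beta> \<gamma> \<delta> \<mu> h q \<longleftrightarrow> univalent q \<and>
     (\<forall>p\<in>class_R \<alpha> \<beta> \<gamma> \<delta> \<mu>. BB_expr \<alpha> \<beta> \<gamma> \<delta> \<mu> p \<prec> h \<longrightarrow> p \<prec> q)"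

definition best_dominant ::
  "real \<Rightarrow> complex \<Rightarrow> complex \<Rightarrow> complex \<Rightarrow> real \<Rightarrow> (complex \<Rightarrow> complex) \<Rightarrow> (complex \<Rightarrow> complex) \<Rightarrow> bool"
where
  "best_dominant \<alpha> \<beta> \<gamma> \<delta> \<mu> h q \<longleftrightarrow> dominant \<alpha> \<beta> \<gamma> \<delta> \<mu> h q \<and>
     (\<forall>q'. dominant \<alpha> \<beta> \<gamma> \<delta> \<mu> h q' \<longrightarrow> q \<prec> q')"

end

theory Submission
  imports Defs
begin

text \<open>
  Raising the expression to the power \<open>1/\<mu>\<close> turns the claim into the Miller--Mocanu setting
  \<open>\<theta>(p) + z p' \<phi>(p) \<prec> h = \<theta>(q) + Q\<close> with \<open>Q = z q' \<phi>(q)\<close> starlike and \<open>Re (z h' / Q) > 0\<close>.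
  If \<open>p\<close> is not subordinate to \<open>q\<close>, Jack's lemma at a first exit point gives \<open>p z0 = q \<zeta>0\<close> and
  \<open>z0 p'(z0) = m \<zeta>0 q'(\<zeta>0)\<close> with \<open>m \<ge> 1\<close> and \<open>norm z0 < norm \<zeta>0\<close>, so that \<open>h \<zeta>0 + (m - 1) Q \<zeta>0\<close> is
  a value of \<open>h\<close> at a point of modulus at most \<open>norm z0\<close>. This is impossible: the map \<open>\<Phi>\<close> with
  \<open>z \<Phi>' = Q\<close> is convex, \<open>Q \<zeta>0\<close> is an outer normal of the image of the disc of radius \<open>norm \<zeta>0\<close>, and
  the derivative of \<open>h\<close> with respect to \<open>\<Phi>\<close> has positive real part, so chords of that image are
  turned by less than a right angle.
\<close>

section \<open>Convex and close-to-convex maps\<close>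

lemma has_real_derivative_Re_of_real:
  assumes "(g has_field_derivative d) (at 0)"
  shows "((\<lambda>t::real. Re (g (of_real t))) has_real_derivative Re d) (at 0)"
  using has_field_derivative_Re[OF has_vector_derivative_real_field[of g d 0]] assms by simp

text \<open>The variations below carry a complex parameter, so that complex rules compute
  \<open>d\<close>, but the minimum is taken over its real values only, such as angles of
  rotation.\<close>

lemma Re_derivative_eq_0_at_min:
  assumes "(g has_field_derivative d) (at 0)" and "\<And>t::real. Re (g 0) \<le> Re (g (of_real t))"
  shows "Re d = 0"
  using DERIV_local_min[OF has_real_derivative_Re_of_real[OF assms(1)], of 1] assms(2) by simp

text \<open>One-sided because radial variations may only shrink the modulus: a growing one could
  leave the closed disc over which the minimum is taken.\<close>

lemma Re_derivative_le_0_at_left_min: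
  assumes "(g has_field_derivative d) (at 0)" and "\<And>t::real. t \<le> 0 \<Longrightarrow> Re (g 0) \<le> Re (g (of_real t))"
  shows "Re d \<le> 0"
proof (rule ccontr)
  assume "\<not> Re d \<le> 0"
  then obtain e where e: "e > 0" "\<And>h. 0 < h \<Longrightarrow> h < e \<Longrightarrow> Re (g (of_real (0 - h))) < Re (g 0)"
    using has_real_derivative_pos_inc_left[OF has_real_derivative_Re_of_real[OF assms(1)]] by fastforce
  with assms(2)[of "- (e/2)"] e(2)[of "e/2"] show False by simp
qed

text \<open>Along the segment from \<open>a\<close> to \<open>b\<close>, the increment of
  \<open>f\<close> divided by \<open>b - a\<close> has derivative \<open>f'\<close>, so its real
  part increases strictly from 0.\<close>

lemma Noshiro_Warschawski:
  assumes "convex S" and der: "\<And>z. z \<in> S \<Longrightarrow> (f has_field_derivative f' z) (at z)"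
    and pos: "\<And>z. z \<in> S \<Longrightarrow> Re (f' z) > 0" and ab: "a \<in> S" "b \<in> S" "a \<noteq> b"
  shows "Re ((f b - f a) / (b - a)) > 0"
proof -
  define u where "u t = Re ((f (a + of_real t * (b - a)) - f a) / (b - a))" for t :: real
  have mem: "a + of_real t * (b - a) \<in> S" if "0 \<le> t" "t \<le> 1" for t :: real
  proof -
    have "(1 - t) *\<^sub>R a + t *\<^sub>R b \<in> S"
      using \<open>convex S\<close> ab that by (simp add: convex_alt)
    then show ?thesis by (simp add: scaleR_conv_of_real algebra_simps)
  qed
  have "\<exists>y. (u has_real_derivative y) (at t) \<and> 0 < y" if "0 \<le> t" "t \<le> 1" for t :: real
  proof -
    have "((\<lambda>w. (f (a + w * (b - a)) - f a) / (b - a)) has_field_derivative f' (a + of_real t * (b - a))) (at (of_real t))"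
      using ab by (auto intro!: derivative_eq_intros
          DERIV_chain2[where f = f and g = "\<lambda>w. a + w * (b - a)", OF der[OF mem[OF that]]])
    from has_field_derivative_Re[OF has_vector_derivative_real_field[OF this]]
    have "(u has_real_derivative Re (f' (a + of_real t * (b - a)))) (at t)" unfolding u_def .
    then show ?thesis using pos[OF mem[OF that]] by blast
  qed
  then have "u 0 < u 1" by (rule DERIV_pos_imp_increasing[OF zero_less_one])
  then show ?thesis by (simp add: u_def)
qed

text \<open>In \<open>support\<close> the data are \<open>a = \<phi> s\<close>,
  \<open>b = deriv \<phi> s\<close> and \<open>n = \<Phi> s - \<Phi> (l * s)\<close>: this is the
  derivative of \<open>n / (s * \<phi> s)\<close> when \<open>s\<close> is rotated and the point
  \<open>l * s\<close> stays fixed.\<close>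

lemma quotient_derivative_1:
  fixes s a b n :: complex
  assumes "s \<noteq> 0" "a \<noteq> 0"
  shows "(a * (\<i> * s) * (s * a) - n * (\<i> * s * a + b * (\<i> * s) * s)) / (s * a * (s * a)) =
    \<i> * (1 - n / (s * a) * (1 + s * b / a))"
proof -
  define u v where "u = b / a" and "v = n / (s * a)"
  have uv: "b = u * a" "n = v * (s * a)" using assms by (simp_all add: u_def v_def)
  have "a * (\<i> * s) * (s * a) - n * (\<i> * s * a + b * (\<i> * s) * s) = \<i> * (1 - v * (1 + s * u)) * (s * a * (s * a))"
    unfolding uv by algebra
  then show ?thesis using assms by (simp add: u_def v_def)
qed

text \<open>The companion for scaling \<open>s\<close> with \<open>l\<close> fixed: the second point
  \<open>c = l * s\<close> now moves as well and, with \<open>d = \<phi> (l * s)\<close>,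
  contributes the last term.\<close>

lemma quotient_derivative_2:
  fixes s a b n c :: complex
  assumes "s \<noteq> 0" "a \<noteq> 0"
  shows "((a * s - d * c) * (s * a) - n * (s * a + b * s * s)) / (s * a * (s * a)) =
    1 - n / (s * a) * (1 + s * b / a) - c * d / (s * a)"
proof -
  define u v x where "u = b / a" and "v = n / (s * a)" and "x = c * d / (s * a)"
  have uv: "b = u * a" "n = v * (s * a)" "c * d = x * (s * a)" using assms by (simp_all add: u_def v_def x_def)
  have "(a * s - d * c) * (s * a) - n * (s * a + b * s * s) = (1 - v * (1 + s * u) - x) * (s * a * (s * a))"
    using uv by algebra
  then show ?thesis using assms by (simp add: u_def v_def x_def)
qed

section \<open>Starlikeness, supporting half-planes and convex images\<close>

text \<open>The condition \<open>pos\<close> is the classical analytic criterion for convexity of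
  \<open>\<Phi>\<close>, or equivalently for starlikeness of \<open>z * \<phi> z\<close>.\<close>

locale convex_map =
  fixes \<Phi> \<phi> :: "complex \<Rightarrow> complex"
  assumes hol: "\<phi> holomorphic_on \<D>"
    and nz: "\<And>z. z \<in> \<D> \<Longrightarrow> \<phi> z \<noteq> 0"
    and pos: "\<And>z. z \<in> \<D> \<Longrightarrow> Re (1 + z * deriv \<phi> z / \<phi> z) > 0"
    and der: "\<And>z. z \<in> \<D> \<Longrightarrow> (\<Phi> has_field_derivative \<phi> z) (at z)"
begin

lemma der_\<phi>: "z \<in> \<D> \<Longrightarrow> (\<phi> has_field_derivative deriv \<phi> z) (at z)"
  using hol by (simp add: holomorphic_derivI)

text \<open>
  In the coordinate \<open>s = Ln z\<close> the function \<open>Ln (z \<phi> z)\<close> has a derivative of positive real part on a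
  half-plane, so the Noshiro--Warschawski inequality applies to it.
\<close>

lemma starlike:
  assumes "z \<in> \<D>" "\<zeta> \<in> \<D>" "\<zeta> \<noteq> 0" "1 \<le> \<kappa>" and eq: "z * \<phi> z = of_real \<kappa> * (\<zeta> * \<phi> \<zeta>)"
  shows "z = \<zeta> \<or> norm \<zeta> < norm z"
proof -
  obtain g where g: "g holomorphic_on \<D>" "\<And>z. z \<in> \<D> \<Longrightarrow> \<phi> z = exp (g z)"
    using holomorphic_logarithm_exists[of \<D> \<phi> 0] hol nz by (metis centre_in_ball convex_ball open_ball zero_less_one)
  define S where "S = {s. Re s < 0}"
  define G where "G s = s + g (exp s)" for s
  have expD: "exp s \<in> \<D>" if "s \<in> S" for s using that by (simp add: S_def)
  have dG: "(G has_field_derivative (1 + exp s * deriv \<phi> (exp s) / \<phi> (exp s))) (at s)" if "s \<in> S" for s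
  proof -
    have dg: "(g has_field_derivative deriv g z) (at z)" if "z \<in> \<D>" for z
      using g(1) that by (simp add: holomorphic_derivI)
    have "deriv \<phi> z = deriv g z * \<phi> z" if "z \<in> \<D>" for z
    proof (rule DERIV_imp_deriv)
      have "((\<lambda>z. exp (g z)) has_field_derivative deriv g z * \<phi> z) (at z)"
        using that by (auto intro!: derivative_eq_intros dg simp: g(2))
      then show "(\<phi> has_field_derivative deriv g z * \<phi> z) (at z)"
        by (rule has_field_derivative_transform_within_open[OF _ open_ball that]) (simp add: g(2))
    qed
    then have "deriv \<phi> (exp s) / \<phi> (exp s) = deriv g (exp s)" using expD[OF that] nz by simp
    moreover have "(G has_field_derivative (1 + exp s * deriv g (exp s))) (at s)"
      unfolding G_def by (auto intro!: derivative_eq_intros DERIV_chain2[where f = g and g = exp, OF dg[OF expD[OF that]]])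
    ultimately show ?thesis by (simp only: times_divide_eq_right[symmetric])
  qed
  have "z \<noteq> 0" using eq assms nz by auto
  have expG: "exp (G s) = exp s * \<phi> (exp s)" if "s \<in> S" for s
    using g(2) expD[OF that] by (simp add: G_def exp_add)
  have LnS: "Ln x \<in> S" if "x \<in> \<D>" "x \<noteq> 0" for x using that by (simp add: S_def)
  have "exp (G (Ln z)) = exp (G (Ln \<zeta>) + of_real (ln \<kappa>))"
    using expG[OF LnS] assms \<open>z \<noteq> 0\<close> by (simp add: exp_add exp_of_real)
  then obtain n :: int where n: "G (Ln z) = G (Ln \<zeta>) + of_real (ln \<kappa>) + of_int (2 * n) * pi * \<i>"
    unfolding exp_eq by blast
  \<comment> \<open>Shifting \<open>s\<close> by a multiple of \<open>2 * pi * \<i>\<close> leaves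
    \<open>exp s\<close> unchanged and shifts \<open>G s\<close> by the same amount. This absorbs
    the ambiguity of the logarithm and leaves the real number \<open>ln \<kappa>\<close>.\<close>
  define s where "s = Ln z - of_int (2 * n) * pi * \<i>"
  have "exp s = z" unfolding s_def using \<open>z \<noteq> 0\<close>
    by (metis exp_Ln exp_eq diff_add_cancel)
  then have Gs: "G s - G (Ln \<zeta>) = of_real (ln \<kappa>)" using n \<open>z \<noteq> 0\<close> by (simp add: G_def s_def algebra_simps)
  have sS: "s \<in> S" "Re s = ln (norm z)" using LnS[of z] assms \<open>z \<noteq> 0\<close> by (auto simp: S_def s_def)
  show ?thesis
  proof (cases "s = Ln \<zeta>")
    case True
    then show ?thesis using \<open>exp s = z\<close> assms by simp
  next
    case False
    have "Re ((G s - G (Ln \<zeta>)) / (s - Ln \<zeta>)) > 0"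
      using False sS LnS[of \<zeta>] assms pos expD dG
      by (intro Noshiro_Warschawski[of S G "\<lambda>s. 1 + exp s * deriv \<phi> (exp s) / \<phi> (exp s)"])
         (auto simp: S_def convex_halfspace_Re_lt)
    \<comment> \<open>Positivity forces \<open>\<kappa> > 1\<close> together with
      \<open>Re s > Re (Ln \<zeta>)\<close>; these real parts are the logarithms of the
      moduli.\<close>
    then have "0 < ln \<kappa> * Re (s - Ln \<zeta>) / (norm (s - Ln \<zeta>))\<^sup>2"
      unfolding Gs by (simp add: Re_divide cmod_power2)
    then have "0 < Re (s - Ln \<zeta>)" using assms(4)
      by (auto simp: zero_less_divide_iff zero_less_mult_iff)
    then show ?thesis using sS assms \<open>z \<noteq> 0\<close> by simp
  qed
qed

text \<open>
  At a minimum of the real part over \<open>norm \<zeta> \<le> R\<close>, \<open>norm (z / \<zeta>) \<le> k < 1\<close> with nonpositive value,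
  three variations show that \<open>z \<phi> z\<close> is a real multiple \<open>\<kappa> \<ge> 1\<close> of \<open>\<zeta> \<phi> \<zeta>\<close>, which contradicts
  starlikeness.
\<close>

lemma support:
  assumes "norm z < norm \<zeta>" "\<zeta> \<in> \<D>"
  shows "Re ((\<Phi> \<zeta> - \<Phi> z) / (\<zeta> * \<phi> \<zeta>)) > 0"
proof -
  define \<Psi> where "\<Psi> w = \<Phi> w - \<Phi> 0" for w
  have der\<Psi>: "(\<Psi> has_field_derivative \<phi> w) (at w)" if "w \<in> \<D>" for w
    unfolding \<Psi>_def using that by (auto intro!: derivative_eq_intros der)
  have "\<Psi> holomorphic_on \<D>" using der\<Psi> by (force simp: holomorphic_on_open)
  moreover have "\<Psi> 0 = 0" by (simp add: \<Psi>_def)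
  ultimately obtain X where X: "X holomorphic_on \<D>" "\<And>w. norm w < 1 \<Longrightarrow> \<Psi> w = w * X w" "deriv \<Psi> 0 = X 0"
    by (rule Schwarz3) auto
  have X0: "X 0 = \<phi> 0" using X(3) der\<Psi>[of 0] by (simp add: DERIV_imp_deriv)
  define R where "R = norm \<zeta>"
  define k where "k = norm z / norm \<zeta>"
  have R: "0 < R" "R < 1" and k: "0 \<le> k" "k < 1"
    using assms le_less_trans[OF norm_ge_zero assms(1)] by (auto simp: R_def k_def)
  \<comment> \<open>The quotient \<open>(\<Phi> x - \<Phi> (y * x)) / (x * \<phi> x)\<close>,
    extended continuously across \<open>x = 0\<close>. The pair \<open>(x, y)\<close> encodes the
    points \<open>x\<close> and \<open>y * x\<close>, which makes the parameter set compact.\<close>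
  define F where "F x = (X (fst x) - snd x * X (snd x * fst x)) / \<phi> (fst x)" for x
  define K where "K = cball (0::complex) R \<times> cball (0::complex) k"
  have KD: "fst x \<in> \<D>" "snd x * fst x \<in> \<D>" if "x \<in> K" for x
  proof -
    have *: "norm (fst x) \<le> R" "norm (snd x) \<le> k" using that by (auto simp: K_def)
    then show "fst x \<in> \<D>" using R by simp
    have "norm (snd x * fst x) \<le> k * R" unfolding norm_mult using * k by (intro mult_mono) auto
    also have "\<dots> \<le> R" using k R by (simp add: mult_left_le_one_le)
    also note R(2)
    finally show "snd x * fst x \<in> \<D>" by simp
  qed
  have contX: "continuous_on \<D> X" and cont\<phi>: "continuous_on \<D> \<phi>"
    using X hol by (auto intro: holomorphic_on_imp_continuous_on)
  have "continuous_on K F" unfolding F_def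
    using KD nz by (intro continuous_intros continuous_on_compose2[OF contX] continuous_on_compose2[OF cont\<phi>]) auto
  then have "continuous_on K (\<lambda>x. Re (F x))" by (intro continuous_intros)
  moreover have "compact K" "K \<noteq> {}" using R k by (auto simp: K_def compact_Times)
  ultimately obtain m where m: "m \<in> K" "\<And>x. x \<in> K \<Longrightarrow> Re (F m) \<le> Re (F x)"
    using continuous_attains_inf by metis
  obtain s l where ml: "m = (s, l)" by force
  have sl: "norm s \<le> R" "norm l \<le> k" using m ml by (auto simp: K_def)
  have Feq: "F (x, y) = (\<Phi> x - \<Phi> (y * x)) / (x * \<phi> x)" if "(x, y) \<in> K" "x \<noteq> 0" for x y
  proof -
    have "\<Phi> x - \<Phi> (y * x) = x * (X x - y * X (y * x))"
      using X(2)[of x] X(2)[of "y * x"] KD[OF that(1)] by (simp add: \<Psi>_def algebra_simps)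
    then show ?thesis using that by (simp add: F_def)
  qed
  have "Re (F m) > 0"
  proof (rule ccontr)
    assume neg: "\<not> Re (F m) > 0"
    \<comment> \<open>At the origin the extended quotient is \<open>1 - l\<close>, whose real part
      is at least \<open>1 - k > 0\<close>.\<close>
    have "s \<noteq> 0"
    proof
      assume "s = 0"
      then have "F m = 1 - l" using nz[of 0] by (simp add: F_def ml X0 field_simps)
      moreover have "Re l < 1" using complex_Re_le_cmod[of l] sl k by linarith
      ultimately show False using neg by simp
    qed
    have mK: "(s, l) \<in> K" using m ml by simp
    have sD: "s \<in> \<D>" "l * s \<in> \<D>" using KD[OF mK] by auto
    define P where "P = 1 + s * deriv \<phi> s / \<phi> s"
    define \<kappa> where "\<kappa> = l * s * \<phi> (l * s) / (s * \<phi> s)"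
    have P: "Re P > 0" using pos[OF sD(1)] by (simp add: P_def)
    have Fm: "F m = (\<Phi> s - \<Phi> (l * s)) / (s * \<phi> s)" using Feq[OF mK \<open>s \<noteq> 0\<close>] ml by simp
    have ns: "\<phi> s \<noteq> 0" using nz sD by simp
    \<comment> \<open>First variation: rotate \<open>s\<close> and counter-rotate \<open>l\<close>,
      so that \<open>l * s\<close> stays fixed.\<close>
    have 1: "Im (F m * P) = 0"
    proof -
      define g where "g w = (\<Phi> (s * exp (\<i> * w)) - \<Phi> (l * s)) / (s * exp (\<i> * w) * \<phi> (s * exp (\<i> * w)))" for w
      have e: "((\<lambda>w. s * exp (\<i> * w)) has_field_derivative \<i> * s) (at 0)"
        by (auto intro!: derivative_eq_intros)
      have "((\<lambda>w. \<Phi> (s * exp (\<i> * w)) - \<Phi> (l * s)) has_field_derivative \<phi> s * (\<i> * s)) (at 0)"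
        using DERIV_chain2[OF _ e, of \<Phi> "\<phi> s"] der[OF sD(1)] by (auto intro!: derivative_eq_intros)
      moreover have "((\<lambda>w. s * exp (\<i> * w) * \<phi> (s * exp (\<i> * w))) has_field_derivative
          \<i> * s * \<phi> s + deriv \<phi> s * (\<i> * s) * s) (at 0)"
        using DERIV_mult[OF e DERIV_chain2[OF _ e, of \<phi> "deriv \<phi> s"]] der_\<phi>[OF sD(1)] by simp
      ultimately have "(g has_field_derivative (\<phi> s * (\<i> * s) * (s * \<phi> s) - (\<Phi> s - \<Phi> (l * s)) *
          (\<i> * s * \<phi> s + deriv \<phi> s * (\<i> * s) * s)) / (s * \<phi> s * (s * \<phi> s))) (at 0)"
        unfolding g_def using DERIV_divide \<open>s \<noteq> 0\<close> ns by fastforce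
      moreover have "(\<phi> s * (\<i> * s) * (s * \<phi> s) - (\<Phi> s - \<Phi> (l * s)) *
          (\<i> * s * \<phi> s + deriv \<phi> s * (\<i> * s) * s)) / (s * \<phi> s * (s * \<phi> s)) = \<i> * (1 - F m * P)"
        unfolding Fm P_def by (rule quotient_derivative_1[OF \<open>s \<noteq> 0\<close> ns])
      ultimately have "(g has_field_derivative \<i> * (1 - F m * P)) (at 0)" by simp
      moreover have "Re (g 0) \<le> Re (g (of_real t))" for t :: real
      proof -
        have "(s * exp (\<i> * t), l * exp (- (\<i> * t))) \<in> K"
          using sl by (simp add: K_def norm_mult)
        from m(2)[OF this] Feq[OF this] show ?thesis
          using \<open>s \<noteq> 0\<close> by (simp add: g_def Fm exp_minus field_simps)
      qed
      ultimately have "Re (\<i> * (1 - F m * P)) = 0" by (rule Re_derivative_eq_0_at_min)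
      then show ?thesis by simp
    qed
    \<comment> \<open>Second variation: rotate \<open>l\<close> alone, so that only the point
      \<open>l * s\<close> moves.\<close>
    have 2: "Im \<kappa> = 0"
    proof -
      define g where "g w = (\<Phi> s - \<Phi> (l * s * exp (\<i> * w))) / (s * \<phi> s)" for w
      have "(g has_field_derivative - \<i> * \<kappa>) (at 0)"
      proof -
        have e: "((\<lambda>w. l * s * exp (\<i> * w)) has_field_derivative \<i> * (l * s)) (at 0)"
          by (auto intro!: derivative_eq_intros)
        have "((\<lambda>w. \<Phi> (l * s * exp (\<i> * w))) has_field_derivative \<phi> (l * s) * (\<i> * (l * s))) (at 0)"
          using DERIV_chain2[OF _ e, of \<Phi> "\<phi> (l * s)"] der[OF sD(2)] by simp
        then show ?thesis unfolding g_def \<kappa>_def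
          using \<open>s \<noteq> 0\<close> ns by (auto intro!: derivative_eq_intros)
      qed
      moreover have "Re (g 0) \<le> Re (g (of_real t))" for t :: real
      proof -
        have "(s, l * exp (\<i> * t)) \<in> K"
          using sl by (simp add: K_def norm_mult)
        from m(2)[OF this] Feq[OF this] show ?thesis
          using \<open>s \<noteq> 0\<close> by (simp add: g_def Fm mult_ac)
      qed
      ultimately have "Re (- \<i> * \<kappa>) = 0" by (rule Re_derivative_eq_0_at_min)
      then show ?thesis by simp
    qed
    \<comment> \<open>Third variation: scale \<open>s\<close> with \<open>l\<close> fixed. Only
      shrinking is admissible, since \<open>norm s\<close> may equal \<open>R\<close>.\<close>
    have 3: "Re (1 - F m * P - \<kappa>) \<le> 0"
    proof -
      define g where "g w = (\<Phi> (s * exp w) - \<Phi> (l * s * exp w)) / (s * exp w * \<phi> (s * exp w))" for w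
      have "(g has_field_derivative 1 - F m * P - \<kappa>) (at 0)"
      proof -
        have e: "((\<lambda>w. c * exp w) has_field_derivative c) (at 0)" for c :: complex
          by (auto intro!: derivative_eq_intros)
        have "((\<lambda>w. \<Phi> (s * exp w) - \<Phi> (l * s * exp w)) has_field_derivative \<phi> s * s - \<phi> (l * s) * (l * s)) (at 0)"
          using DERIV_chain2[OF _ e[of s], of \<Phi> "\<phi> s"] DERIV_chain2[OF _ e[of "l * s"], of \<Phi> "\<phi> (l * s)"]
            der[OF sD(1)] der[OF sD(2)] by (auto intro!: DERIV_diff)
        moreover have "((\<lambda>w. s * exp w * \<phi> (s * exp w)) has_field_derivative s * \<phi> s + deriv \<phi> s * s * s) (at 0)"
          using DERIV_mult[OF e[of s] DERIV_chain2[OF _ e[of s], of \<phi> "deriv \<phi> s"]] der_\<phi>[OF sD(1)] by simp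
        ultimately have "(g has_field_derivative ((\<phi> s * s - \<phi> (l * s) * (l * s)) * (s * \<phi> s) - (\<Phi> s - \<Phi> (l * s)) *
            (s * \<phi> s + deriv \<phi> s * s * s)) / (s * \<phi> s * (s * \<phi> s))) (at 0)"
          unfolding g_def using DERIV_divide \<open>s \<noteq> 0\<close> ns by fastforce
        moreover have "((\<phi> s * s - \<phi> (l * s) * (l * s)) * (s * \<phi> s) - (\<Phi> s - \<Phi> (l * s)) *
            (s * \<phi> s + deriv \<phi> s * s * s)) / (s * \<phi> s * (s * \<phi> s)) = 1 - F m * P - \<kappa>"
          unfolding Fm P_def \<kappa>_def by (rule quotient_derivative_2[OF \<open>s \<noteq> 0\<close> ns])
        ultimately show ?thesis by simp
      qed
      moreover have "Re (g 0) \<le> Re (g (of_real t))" if "t \<le> 0" for t :: real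
      proof -
        have "norm s * exp t \<le> R * 1"
          using sl that R by (intro mult_mono) auto
        then have "(s * exp t, l) \<in> K"
          using sl by (simp add: K_def norm_mult)
        from m(2)[OF this] Feq[OF this] show ?thesis
          using \<open>s \<noteq> 0\<close> by (simp add: g_def Fm mult_ac exp_of_real)
      qed
      ultimately show ?thesis by (rule Re_derivative_le_0_at_left_min)
    qed
    \<comment> \<open>The product is a real number \<open>v\<close>, and \<open>v / P\<close> has a
      real part of the same sign as \<open>v\<close> because \<open>Re P > 0\<close>.\<close>
    have "Re (F m * P) \<le> 0"
    proof -
      define v where "v = Re (F m * P)"
      have "F m * P = of_real v" using 1 by (simp add: v_def complex_eq_iff)
      then have "F m = of_real v / P" using P by (metis nonzero_eq_divide_eq zero_complex.sel(1) less_irrefl)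
      then have "Re (F m) = v * Re P / (norm P)\<^sup>2" by (simp add: Re_divide cmod_power2)
      moreover have "norm P > 0" using P by auto
      ultimately have "\<not> v > 0" using neg P by auto
      then show ?thesis by (simp add: v_def)
    qed
    with 3 have "Re \<kappa> \<ge> 1" by simp
    moreover have "\<kappa> = of_real (Re \<kappa>)" using 2 by (simp add: complex_eq_iff)
    ultimately have "l * s = s \<or> norm s < norm (l * s)"
      using sD \<open>s \<noteq> 0\<close> ns by (intro starlike[of "l * s" s "Re \<kappa>"]) (auto simp: \<kappa>_def field_simps)
    moreover have "norm (l * s) < norm s" using \<open>s \<noteq> 0\<close> sl k by (simp add: norm_mult)
    ultimately show False by auto
  qed
  moreover have zK: "(\<zeta>, z / \<zeta>) \<in> K" using R k assms by (auto simp: K_def R_def k_def norm_divide)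
  ultimately have "Re (F (\<zeta>, z / \<zeta>)) > 0" using m(2) by force
  then show ?thesis using Feq[OF zK] R by (auto simp: R_def)
qed

lemma holomorphic_\<Phi>: "\<Phi> holomorphic_on \<D>"
  using der by (force simp: holomorphic_on_open)

text \<open>For unequal moduli \<open>support\<close> separates the values. For equal moduli, a
  common value makes \<open>b\<close> a minimum in the limiting support inequality on the closed
  disc; variations there make \<open>b * \<phi> b\<close> a positive multiple of
  \<open>a * \<phi> a\<close>, which starlikeness forbids.\<close>

lemma inj_on_disc: "inj_on \<Phi> \<D>"
proof -
  have "a = b" if ab: "a \<in> \<D>" "b \<in> \<D>" "norm b \<le> norm a" and eq: "\<Phi> a = \<Phi> b" for a b
  proof (rule ccontr)
    assume "a \<noteq> b"
    have na: "norm b = norm a" using support[of b a] ab eq by force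
    have nz': "a \<noteq> 0" "b \<noteq> 0" using na \<open>a \<noteq> b\<close> by auto
    have \<phi>nz: "\<phi> a \<noteq> 0" "\<phi> b \<noteq> 0" using nz ab by auto
    define r where "r = norm a"
    have r: "0 < r" "r < 1" using ab nz' by (auto simp: r_def)
    define u where "u z = Re ((\<Phi> a - \<Phi> z) / (a * \<phi> a))" for z
    have ge: "0 \<le> u z" if "norm z \<le> r" for z
    proof (rule continuous_ge_on_closure[of "ball 0 r" u])
      have "continuous_on \<D> \<Phi>"
        by (rule holomorphic_on_imp_continuous_on[OF holomorphic_\<Phi>])
      then have "continuous_on (cball 0 r) \<Phi>"
        by (rule continuous_on_subset) (use r in auto)
      then show "continuous_on (closure (ball 0 r)) u"
        unfolding u_def using nz' \<phi>nz r by (auto intro!: continuous_intros)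
      show "z \<in> closure (ball 0 r)" using that r by simp
      show "0 \<le> u x" if "x \<in> ball 0 r" for x
        using support[of x a] that ab by (simp add: u_def r_def less_imp_le)
    qed
    define \<kappa> where "\<kappa> = b * \<phi> b / (a * \<phi> a)"
    have \<kappa>_deriv: "((\<lambda>w. (\<Phi> a - \<Phi> (b * exp (c * w))) / (a * \<phi> a)) has_field_derivative - c * \<kappa>) (at 0)" for c
    proof -
      have e: "((\<lambda>w. b * exp (c * w)) has_field_derivative c * b) (at 0)"
        by (auto intro!: derivative_eq_intros)
      have "((\<lambda>w. \<Phi> (b * exp (c * w))) has_field_derivative \<phi> b * (c * b)) (at 0)"
        using DERIV_chain2[OF _ e, of \<Phi> "\<phi> b"] der[OF ab(2)] by simp
      then show ?thesis unfolding \<kappa>_def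
        using nz' \<phi>nz by (auto intro!: derivative_eq_intros)
    qed
    have "Re (- \<i> * \<kappa>) = 0"
      using ge[of "b * exp (\<i> * of_real t)" for t] eq na
      by (intro Re_derivative_eq_0_at_min[OF \<kappa>_deriv]) (auto simp: u_def r_def norm_mult)
    moreover have "Re (- 1 * \<kappa>) \<le> 0"
      using ge[of "b * exp (1 * of_real t)" for t] eq na
      by (intro Re_derivative_le_0_at_left_min[OF \<kappa>_deriv])
         (auto simp: u_def r_def norm_mult mult_left_le)
    moreover have "\<kappa> \<noteq> 0" using nz' \<phi>nz by (simp add: \<kappa>_def)
    ultimately obtain x where x: "\<kappa> = of_real x" "x > 0"
      by (metis complex_eq_iff Im_complex_of_real Re_complex_of_real add_0 complex_Re_numeral
          less_eq_real_def mult_minus_left mult_1 neg_le_0_iff_le Re_i_times minus_complex.sel uminus_complex.sel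
          of_real_0 minus_minus)
    have eq1: "b * \<phi> b = of_real x * (a * \<phi> a)" and eq2: "a * \<phi> a = of_real (1/x) * (b * \<phi> b)"
      using x nz' \<phi>nz by (auto simp: \<kappa>_def field_simps)
    show False
    \<comment> \<open>\<open>starlike\<close> wants a factor of at least 1, so for
      \<open>x < 1\<close> the two points are exchanged.\<close>
    proof (cases "x \<ge> 1")
      case True
      then show False using starlike[OF ab(2,1) nz'(1) _ eq1] na \<open>a \<noteq> b\<close> by auto
    next
      case False
      then show False using starlike[OF ab(1,2) nz'(2) _ eq2] x na \<open>a \<noteq> b\<close> by auto
    qed
  qed
  then show ?thesis unfolding inj_on_def by (metis linear)
qed

text \<open>By \<open>support\<close>, all image points lie strictly inside a half-plane bounded by
  a line through the boundary point \<open>\<Phi> \<zeta>\<close>. A segment leaving the image would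
  meet such a boundary point as a convex combination of image points.\<close>

lemma convex_image_ball:
  assumes "0 < r" "r < 1"
  shows "convex (\<Phi> ` ball 0 r)"
proof (rule ccontr)
  define U where "U = \<Phi> ` ball 0 r"
  assume "\<not> convex (\<Phi> ` ball 0 r)"
  then obtain x y m where xy: "x \<in> U" "y \<in> U" "m \<in> closed_segment x y" "m \<notin> U"
    unfolding U_def[symmetric] convex_contains_segment by blast
  have sub: "ball 0 r \<subseteq> \<D>" "cball 0 r \<subseteq> \<D>" using assms by auto
  have "open U" unfolding U_def
    using holomorphic_\<Phi> inj_on_disc sub by (meson open_mapping_thm3 holomorphic_on_subset inj_on_subset open_ball)
  have "closed_segment x y \<inter> frontier U \<noteq> {}"
    using xy by (intro connected_Int_frontier) auto
  then obtain b where b: "b \<in> closed_segment x y" "b \<in> frontier U" by blast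
  have "compact (\<Phi> ` cball 0 r)"
    using holomorphic_\<Phi> sub by (meson compact_cball compact_continuous_image holomorphic_on_imp_continuous_on holomorphic_on_subset)
  then have "closure U \<subseteq> \<Phi> ` cball 0 r"
    unfolding U_def by (intro closure_minimal compact_imp_closed image_mono ball_subset_cball)
  moreover have "b \<in> closure U" "b \<notin> U"
    using b \<open>open U\<close> by (auto simp: frontier_def interior_open)
  ultimately obtain \<zeta> where \<zeta>: "b = \<Phi> \<zeta>" "norm \<zeta> = r"
    by (force simp: U_def)
  have pos: "Re ((b - u) / (\<zeta> * \<phi> \<zeta>)) > 0" if "u \<in> U" for u
    using that \<zeta> assms support[of _ \<zeta>] by (auto simp: U_def)
  obtain t where t: "0 \<le> t" "t \<le> 1" "b = (1 - t) *\<^sub>R x + t *\<^sub>R y"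
    using b by (auto simp: closed_segment_def)
  have "(1 - t) *\<^sub>R ((b - x) / (\<zeta> * \<phi> \<zeta>)) + t *\<^sub>R ((b - y) / (\<zeta> * \<phi> \<zeta>)) = 0"
  proof -
    have "(1 - t) *\<^sub>R (b - x) + t *\<^sub>R (b - y) = b - ((1 - t) *\<^sub>R x + t *\<^sub>R y)"
      by (simp add: scaleR_conv_of_real algebra_simps)
    then have "((1 - t) *\<^sub>R (b - x) + t *\<^sub>R (b - y)) / (\<zeta> * \<phi> \<zeta>) = 0" using t(3) by simp
    then show ?thesis by (simp add: add_divide_distrib scaleR_conv_of_real)
  qed
  then have "(1 - t) * Re ((b - x) / (\<zeta> * \<phi> \<zeta>)) + t * Re ((b - y) / (\<zeta> * \<phi> \<zeta>)) = 0"
    by (metis plus_complex.sel(1) scaleR_complex.sel(1) zero_complex.sel(1))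
  moreover have "(1 - t) * Re ((b - x) / (\<zeta> * \<phi> \<zeta>)) + t * Re ((b - y) / (\<zeta> * \<phi> \<zeta>)) > 0"
    using pos[OF xy(1)] pos[OF xy(2)] t(1,2)
    by (cases "t = 0") (auto intro!: add_nonneg_pos mult_nonneg_nonneg mult_pos_pos simp: less_imp_le)
  ultimately show False by simp
qed

text \<open>The composite of \<open>h\<close> with the inverse of \<open>\<Phi>\<close> lives on a
  convex set and has derivative \<open>h' / \<phi>\<close>, so the quotient \<open>c\<close> of the
  increments of \<open>h\<close> and \<open>\<Phi>\<close> has positive real part. On the ray,
  \<open>(\<Phi> \<zeta> - \<Phi> z) / (\<zeta> * \<phi> \<zeta>)\<close> would be
  \<open>- t / c\<close>, against \<open>support\<close>.\<close>

lemma close_to_convex_ray: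
  assumes der_h: "\<And>z. z \<in> \<D> \<Longrightarrow> (h has_field_derivative h' z) (at z)"
    and pos_h: "\<And>z. z \<in> \<D> \<Longrightarrow> Re (h' z / \<phi> z) > 0"
    and "norm z < norm \<zeta>" "\<zeta> \<in> \<D>" "0 \<le> t"
  shows "h z \<noteq> h \<zeta> + of_real t * (\<zeta> * \<phi> \<zeta>)"
proof
  assume eq: "h z = h \<zeta> + of_real t * (\<zeta> * \<phi> \<zeta>)"
  \<comment> \<open>A radius strictly between \<open>norm \<zeta>\<close> and 1, so that both points
    lie in an open disc with convex image.\<close>
  define r where "r = (norm \<zeta> + 1) / 2"
  have r: "0 < r" "r < 1" "norm \<zeta> < r" "norm z < r"
    using assms norm_ge_zero[of \<zeta>] by (auto simp: r_def simp del: norm_ge_zero)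
  have sub: "ball 0 r \<subseteq> \<D>" using r by auto
  obtain k where k: "k holomorphic_on \<Phi> ` ball 0 r"
      "\<And>z. z \<in> ball 0 r \<Longrightarrow> deriv \<Phi> z * deriv k (\<Phi> z) = 1" "\<And>z. z \<in> ball 0 r \<Longrightarrow> k (\<Phi> z) = z"
    using holomorphic_\<Phi> inj_on_disc sub
    by (meson holomorphic_has_inverse holomorphic_on_subset inj_on_subset open_ball)
  have "open (\<Phi> ` ball 0 r)"
    using holomorphic_\<Phi> inj_on_disc sub by (meson open_mapping_thm3 holomorphic_on_subset inj_on_subset open_ball)
  have dk: "(h \<circ> k has_field_derivative h' (k u) / \<phi> (k u)) (at u)" if u: "u \<in> \<Phi> ` ball 0 r" for u
  proof -
    obtain x where x: "u = \<Phi> x" "x \<in> ball 0 r" using u by blast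
    then have xD: "x \<in> \<D>" using sub by blast
    have "deriv \<Phi> x = \<phi> x" using der[OF xD] by (rule DERIV_imp_deriv)
    then have "deriv k u = 1 / \<phi> x" using k(2)[OF x(2)] x nz[OF xD] by (simp add: field_simps)
    moreover have "(k has_field_derivative deriv k u) (at u)"
      using k(1) \<open>open (\<Phi> ` ball 0 r)\<close> u by (simp add: holomorphic_derivI)
    ultimately have "(k has_field_derivative 1 / \<phi> x) (at u)" by simp
    then show ?thesis
      using DERIV_chain[of h "h' x" k u "1 / \<phi> x" UNIV] der_h[OF xD] k(3)[OF x(2)] x(1) by simp
  qed
  have "Re (h' (k u) / \<phi> (k u)) > 0" if "u \<in> \<Phi> ` ball 0 r" for u
    using that k(3) sub by (auto intro!: pos_h)
  moreover have "\<Phi> z \<noteq> \<Phi> \<zeta>" using inj_on_disc assms unfolding inj_on_def by force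
  ultimately have "Re (((h \<circ> k) (\<Phi> \<zeta>) - (h \<circ> k) (\<Phi> z)) / (\<Phi> \<zeta> - \<Phi> z)) > 0"
    using r by (intro Noshiro_Warschawski[OF convex_image_ball[OF r(1,2)] dk]) auto
  moreover define c where "c = (h \<zeta> - h z) / (\<Phi> \<zeta> - \<Phi> z)"
  ultimately have c: "Re c > 0" using k(3) r by simp
  have nn: "\<zeta> * \<phi> \<zeta> \<noteq> 0" using nz assms by auto
  have "c * (\<Phi> \<zeta> - \<Phi> z) = - of_real t * (\<zeta> * \<phi> \<zeta>)"
    using \<open>\<Phi> z \<noteq> \<Phi> \<zeta>\<close> eq by (simp add: c_def)
  moreover have "c \<noteq> 0" using c by auto
  ultimately have "(\<Phi> \<zeta> - \<Phi> z) / (\<zeta> * \<phi> \<zeta>) = - of_real t / c"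
    using nn by (simp add: field_simps)
  then have "Re ((\<Phi> \<zeta> - \<Phi> z) / (\<zeta> * \<phi> \<zeta>)) = - t * Re c / (norm c)\<^sup>2"
    by (simp add: Re_divide cmod_power2)
  also have "\<dots> \<le> 0" using c assms by (simp add: divide_nonpos_nonneg)
  finally show False using support[OF assms(3,4)] by simp
qed

end

section \<open>The first exit point\<close>

text \<open>For \<open>M = z0 * deriv w z0 / w z0\<close>, maximality of \<open>norm (w z)\<close>
  on the circle makes \<open>M\<close> real, and the Schwarz bound \<open>r * norm z / s\<close>
  along the radius makes \<open>Re M\<close> at least 1.\<close>

lemma Jack:
  assumes hol: "w holomorphic_on S" "open S" "cball 0 s \<subseteq> S" and "0 < s" "w 0 = 0"
    and less: "\<And>z. norm z < s \<Longrightarrow> norm (w z) < r" and z0: "norm z0 = s" "norm (w z0) = r"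
  obtains m where "1 \<le> m" "z0 * deriv w z0 = of_real m * w z0"
proof -
  have "r > 0" using less[of 0] \<open>0 < s\<close> \<open>w 0 = 0\<close> by simp
  then have wnz: "w z0 \<noteq> 0" using z0 by auto
  have "z0 \<in> S" using z0 hol by auto
  then have dw: "(w has_field_derivative deriv w z0) (at z0)" using hol by (simp add: holomorphic_derivI)
  have contr: "norm (w z) \<le> r * norm z / s" if "norm z < s" for z
  proof -
    define f where "f x = w (of_real s * x) / of_real r" for x
    have *: "norm (of_real s * x) < s" if "norm x < 1" for x :: complex
      using that \<open>0 < s\<close> by (simp add: norm_mult)
    have "(w \<circ> (\<lambda>x. of_real s * x)) holomorphic_on \<D>"
      using * hol(3) less_imp_le[OF *]
      by (intro holomorphic_on_compose_gen[OF _ hol(1)] holomorphic_intros) auto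
    then have "f holomorphic_on \<D>" unfolding f_def o_def using \<open>r > 0\<close> by (intro holomorphic_intros) auto
    moreover have "f 0 = 0" using \<open>w 0 = 0\<close> by (simp add: f_def)
    moreover have "norm (f x) < 1" if "norm x < 1" for x
      using less[OF *[OF that]] \<open>r > 0\<close> by (simp add: f_def norm_divide)
    moreover have "norm (z / of_real s) < 1" using that \<open>0 < s\<close> by (simp add: norm_divide)
    ultimately have "norm (f (z / of_real s)) \<le> norm (z / of_real s)" by (rule Schwarz_Lemma(1))
    then show ?thesis using \<open>r > 0\<close> \<open>0 < s\<close> by (simp add: f_def norm_divide field_simps)
  qed
  have le: "norm (w z) \<le> r" if "norm z \<le> s" for z
  proof (rule continuous_le_on_closure[of "ball 0 s" "\<lambda>z. norm (w z)"])
    show "continuous_on (closure (ball 0 s)) (\<lambda>z. norm (w z))"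
      using holomorphic_on_imp_continuous_on[OF hol(1)] hol(3) \<open>0 < s\<close>
      by (auto intro!: continuous_intros intro: continuous_on_subset)
    show "z \<in> closure (ball 0 s)" using that \<open>0 < s\<close> by simp
    show "norm (w x) \<le> r" if "x \<in> ball 0 s" for x using less[of x] that by simp
  qed
  define M where "M = z0 * deriv w z0 / w z0"
  have d: "((\<lambda>x. - (w (z0 * exp (c * x)) / w z0)) has_field_derivative - c * M) (at 0)" for c
  proof -
    have e: "((\<lambda>x. z0 * exp (c * x)) has_field_derivative c * z0) (at 0)"
      by (auto intro!: derivative_eq_intros)
    have "((\<lambda>x. w (z0 * exp (c * x))) has_field_derivative deriv w z0 * (c * z0)) (at 0)"
      using DERIV_chain2[OF _ e, of w "deriv w z0"] dw by simp
    then show ?thesis unfolding M_def using wnz by (auto intro!: derivative_eq_intros)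
  qed
  have Re_ge: "- norm (w x) / r \<le> Re (- (w x / w z0))" for x
    using complex_Re_le_cmod[of "w x / w z0"] z0 by (simp add: norm_divide)
  have "Re (- \<i> * M) = 0"
  proof (rule Re_derivative_eq_0_at_min[OF d])
    fix t :: real
    have "- norm (w (z0 * exp (\<i> * of_real t))) / r \<ge> - 1"
      using le[of "z0 * exp (\<i> * of_real t)"] z0 \<open>r > 0\<close> by (simp add: norm_mult)
    then show "Re (- (w (z0 * exp (\<i> * 0)) / w z0)) \<le> Re (- (w (z0 * exp (\<i> * of_real t)) / w z0))"
      using Re_ge[of "z0 * exp (\<i> * of_real t)"] wnz by simp
  qed
  moreover have "Re (- M + 1) \<le> 0"
  proof -
    \<comment> \<open>The factor \<open>exp (- x)\<close> offsets the Schwarz bound, so that the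
      minimum \<open>- 1\<close> is attained at \<open>t = 0\<close>; it contributes the summand 1
      to the derivative.\<close>
    have "((\<lambda>x. - (w (z0 * exp (1 * x)) / w z0) * exp (- x)) has_field_derivative - M + 1) (at 0)"
    proof -
      have "((\<lambda>x. exp (- x)) has_field_derivative - 1) (at (0::complex))"
        by (auto intro!: derivative_eq_intros)
      from DERIV_mult[OF d[of 1] this] show ?thesis using wnz by simp
    qed
    then show ?thesis
    proof (rule Re_derivative_le_0_at_left_min)
      fix t :: real assume "t \<le> 0"
      have "norm (w (z0 * exp t)) \<le> r * exp t"
      proof (cases "t = 0")
        case False
        then show ?thesis
          using contr[of "z0 * exp t"] \<open>t \<le> 0\<close> z0 \<open>0 < s\<close> by (simp add: norm_mult)
      qed (use z0 in simp)
      then have "norm (w (z0 * exp t)) / r \<le> exp t" using \<open>r > 0\<close> by (simp add: field_simps)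
      then have "- exp t \<le> Re (- (w (z0 * exp t) / w z0))"
        using Re_ge[of "z0 * exp t"] by (simp add: minus_divide_left[symmetric])
      then have "- exp t * exp (- t) \<le> Re (- (w (z0 * exp t) / w z0)) * exp (- t)"
        by (rule mult_right_mono) simp
      moreover have "- exp t * exp (- t) = - 1" by (simp flip: exp_add)
      moreover have "Re (y * exp (- complex_of_real t)) = Re y * exp (- t)" for y
      proof -
        have "exp (- complex_of_real t) = of_real (exp (- t))" by (metis exp_of_real of_real_minus)
        then show ?thesis by simp
      qed
      ultimately have "- 1 \<le> Re (- (w (z0 * exp (1 * of_real t)) / w z0) * exp (- of_real t))"
        by (simp only: mult_1 exp_of_real)
      then show "Re (- (w (z0 * exp (1 * 0)) / w z0) * exp (- 0)) \<le>
          Re (- (w (z0 * exp (1 * of_real t)) / w z0) * exp (- of_real t))"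
        by (simp only: mult_zero_right exp_zero minus_zero mult_1_right divide_self[OF wnz] uminus_complex.sel one_complex.sel)
    qed
  qed
  ultimately have "M = of_real (Re M)" "1 \<le> Re M" by (auto simp: complex_eq_iff)
  then show thesis using that[of "Re M"] wnz by (metis M_def nonzero_divide_eq_eq)
qed

text \<open>If for every radius below 1 the values of \<open>p\<close> on the disc were values of
  \<open>q\<close> on the same disc, the inverse of \<open>q\<close> after \<open>p\<close> would
  realise the subordination. A radius where this fails has a first exit point, to which Jack's lemma
  applies. The map \<open>v\<close> is exported so that logarithms can be compared from 0 to
  \<open>z0\<close>.\<close>

lemma not_subordinate_first_exit:
  fixes p q :: "complex \<Rightarrow> complex"
  assumes q: "univalent q" and p: "p holomorphic_on \<D>" "p 0 = q 0" and "\<not> p \<prec> q"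
  obtains z0 \<zeta>0 m v where "norm z0 < norm \<zeta>0" "\<zeta>0 \<in> \<D>" "(1::real) \<le> m"
    "p z0 = q \<zeta>0" "z0 * deriv p z0 = of_real m * (\<zeta>0 * deriv q \<zeta>0)"
    "continuous_on (cball 0 (norm z0)) v" "v 0 = 0" "v z0 = \<zeta>0"
    "\<And>z. z \<in> cball 0 (norm z0) \<Longrightarrow> v z \<in> \<D> \<and> p z = q (v z)"
proof -
  have qh: "q holomorphic_on \<D>" and qi: "inj_on q \<D>" using q by (auto simp: univalent_def)
  obtain k where k: "k holomorphic_on q ` \<D>" "\<And>z. z \<in> \<D> \<Longrightarrow> k (q z) = z"
    using holomorphic_has_inverse[OF qh open_ball qi] by metis
  have oq: "open (q ` \<D>)" by (rule open_mapping_thm3[OF qh open_ball qi])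
  have "\<exists>r. 0 < r \<and> r < 1 \<and> \<not> p ` ball 0 r \<subseteq> q ` ball 0 r"
  proof (rule ccontr)
    assume "\<nexists>r. 0 < r \<and> r < 1 \<and> \<not> p ` ball 0 r \<subseteq> q ` ball 0 r"
    then have *: "p ` ball 0 r \<subseteq> q ` ball 0 r" if "0 < r" "r < 1" for r using that by blast
    have im: "p z \<in> q ` \<D>" if "z \<in> \<D>" for z
    proof -
      have "norm z < 1" using that by simp
      then obtain r where "norm z < r" "r < 1" using dense by blast
      moreover from this have "0 < r" by (meson norm_ge_zero le_less_trans)
      ultimately have "p z \<in> q ` ball 0 r" "ball 0 r \<subseteq> \<D>" using *[of r] by auto
      then show ?thesis by blast
    qed
    have "p \<prec> q" unfolding subordinate_def
    proof (intro exI conjI ballI)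
      show "(k \<circ> p) holomorphic_on \<D>"
        using im by (intro holomorphic_on_compose_gen[OF p(1) k(1)]) auto
      show "(k \<circ> p) ` \<D> \<subseteq> \<D>" "\<And>z. z \<in> \<D> \<Longrightarrow> p z = q ((k \<circ> p) z)"
        using im k(2) by (auto, (metis im imageE k(2) mem_ball_0)+)
      show "(k \<circ> p) 0 = 0" using p(2) k(2)[of 0] by simp
    qed
    with assms(4) show False by simp
  qed
  then obtain r a where r: "0 < r" "r < 1" and a: "a \<in> ball 0 r" "p a \<notin> q ` ball 0 r" by blast
  have sub: "ball 0 r \<subseteq> \<D>" "cball 0 r \<subseteq> \<D>" using r by auto
  have ob: "open (q ` ball 0 r)"
    using qh qi sub by (meson open_mapping_thm3 holomorphic_on_subset inj_on_subset open_ball)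
  \<comment> \<open>A point of least modulus in this compact set is the first exit. Using the same
    \<open>r\<close> for both discs yields
    \<open>norm z0 \<le> norm a < r = norm \<zeta>\<close>.\<close>
  define A where "A = cball 0 (norm a) \<inter> p -` (- (q ` ball 0 r))"
  have ca: "cball 0 (norm a) \<subseteq> \<D>" using a r by auto
  have "closed A" unfolding A_def
    using ob continuous_on_subset[OF holomorphic_on_imp_continuous_on[OF p(1)] ca]
    by (intro continuous_closed_preimage) auto
  then have "compact A" unfolding A_def by (metis compact_cball compact_Int_closed inf.left_idem inf_commute)
  moreover have "a \<in> A" using a by (auto simp: A_def)
  ultimately obtain z0 where z0: "z0 \<in> A" "\<And>z. z \<in> A \<Longrightarrow> norm z0 \<le> norm z"
    using continuous_attains_inf[of A norm] by (metis continuous_on_norm_id empty_iff)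
  define s where "s = norm z0"
  have z0r: "norm z0 \<le> norm a" "p z0 \<notin> q ` ball 0 r" using z0 by (auto simp: A_def)
  have s: "s < r" using z0r a by (simp add: s_def)
  have "z0 \<noteq> 0" using z0r p(2) r by auto
  then have s0: "0 < s" by (simp add: s_def)
  have inb: "p z \<in> q ` ball 0 r" if "norm z < s" for z
    using z0(2)[of z] that z0r by (force simp: A_def s_def)
  have cs: "cball 0 s \<subseteq> \<D>" using s r by auto
  have inc: "p z \<in> q ` cball 0 r" if "z \<in> cball 0 s" for z
  proof -
    have "compact (q ` cball 0 r)"
      using qh sub by (meson compact_cball compact_continuous_image holomorphic_on_imp_continuous_on holomorphic_on_subset)
    then have "p ` closure (ball 0 s) \<subseteq> q ` cball 0 r"
      using s0 inb holomorphic_on_imp_continuous_on[OF p(1)] cs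
      by (intro image_closure_subset)
         (auto intro: continuous_on_subset compact_imp_closed intro!: image_mono[THEN subsetD, of "ball 0 r" "cball 0 r"])
    then show ?thesis using that s0 by auto
  qed
  \<comment> \<open>Jack's lemma needs \<open>v\<close> holomorphic near the closed disc, so the
    inverse of \<open>q\<close> is taken on the image of the whole unit disc, not only of
    \<open>ball 0 r\<close>.\<close>
  define W where "W = \<D> \<inter> p -` (q ` \<D>)"
  have oW: "open W" unfolding W_def
    using holomorphic_on_imp_continuous_on[OF p(1)] oq by (simp add: continuous_on_open_vimage Int_commute)
  have sW: "cball 0 s \<subseteq> W" using inc cs sub by (fastforce simp: W_def)
  define v where "v = k \<circ> p"
  have vh: "v holomorphic_on W" unfolding v_def
    by (rule holomorphic_on_compose_gen[OF holomorphic_on_subset[OF p(1)] k(1)]) (auto simp: W_def)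
  have v: "v z \<in> \<D> \<and> p z = q (v z)" if "z \<in> W" for z
    using that k(2) by (auto simp: W_def v_def)
  have v0: "v 0 = 0" using p(2) k(2)[of 0] by (simp add: v_def)
  have vless: "norm (v z) < r" if "norm z < s" for z
    using inb[OF that] k(2) sub by (force simp: v_def)
  have z0s: "z0 \<in> cball 0 s" by (simp add: s_def)
  obtain \<zeta> where \<zeta>: "p z0 = q \<zeta>" "norm \<zeta> \<le> r" using inc[OF z0s] by auto
  then have \<zeta>r: "norm \<zeta> = r" using z0r by force
  have "\<zeta> \<in> \<D>" using \<zeta>r r by simp
  then have vz0: "v z0 = \<zeta>" using \<zeta> k(2) by (simp add: v_def)
  obtain m where m: "1 \<le> m" "z0 * deriv v z0 = of_real m * v z0"
    using Jack[OF vh oW sW s0 v0 vless] \<zeta>r vz0 by (metis s_def)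
  have "z0 \<in> W" using sW z0s by blast
  have "deriv p z0 = deriv q \<zeta> * deriv v z0"
  proof (rule DERIV_imp_deriv)
    have "(q has_field_derivative deriv q \<zeta>) (at (v z0))"
      using qh \<open>\<zeta> \<in> \<D>\<close> vz0 by (simp add: holomorphic_derivI)
    moreover have "(v has_field_derivative deriv v z0) (at z0)"
      using vh oW \<open>z0 \<in> W\<close> by (simp add: holomorphic_derivI)
    ultimately have "((\<lambda>z. q (v z)) has_field_derivative deriv q \<zeta> * deriv v z0) (at z0)"
      by (rule DERIV_chain2)
    then show "(p has_field_derivative deriv q \<zeta> * deriv v z0) (at z0)"
      by (rule has_field_derivative_transform_within_open[OF _ oW \<open>z0 \<in> W\<close>]) (use v in auto)
  qed
  then have "z0 * deriv p z0 = deriv q \<zeta> * (z0 * deriv v z0)" by simp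
  then have "z0 * deriv p z0 = of_real m * (\<zeta> * deriv q \<zeta>)" by (simp only: m vz0 mult_ac)
  moreover have "continuous_on (cball 0 s) v"
    using vh sW by (meson holomorphic_on_imp_continuous_on holomorphic_on_subset)
  ultimately show thesis
    using that[of z0 \<zeta> m v] \<zeta> \<zeta>r s \<open>\<zeta> \<in> \<D>\<close> m(1) v0 vz0 v sW by (simp add: s_def subset_iff)
qed

section \<open>Agreement of branches of powers and logarithms\<close>

text \<open>Near \<open>z0\<close> the quotient has modulus 1, so it is constant by the maximum
  principle; the identity theorem extends the equality. Branches of powers can thus be compared
  through their moduli.\<close>

lemma holomorphic_eq_if_norm_eq:
  assumes f: "f holomorphic_on S" and g: "g holomorphic_on S" and S: "open S" "connected S"
    and norm: "\<And>z. z \<in> S \<Longrightarrow> norm (f z) = norm (g z)"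
    and z0: "z0 \<in> S" "f z0 = g z0" "g z0 \<noteq> 0" and "z \<in> S"
  shows "f z = g z"
proof -
  have "continuous_on S g" using g by (rule holomorphic_on_imp_continuous_on)
  then have "open (S \<inter> g -` (- {0}))" using S by (intro continuous_open_preimage) auto
  moreover have "z0 \<in> S \<inter> g -` (- {0})" using z0 by simp
  ultimately obtain e where e: "e > 0" "ball z0 e \<subseteq> S \<inter> g -` (- {0})"
    by (meson openE)
  have "(\<lambda>z. f z / g z) constant_on ball z0 e"
  proof (rule maximum_modulus_principle)
    show "(\<lambda>z. f z / g z) holomorphic_on ball z0 e"
      using e f g by (intro holomorphic_intros) (auto intro: holomorphic_on_subset)
    show "norm (f x / g x) \<le> norm (f z0 / g z0)" if "x \<in> ball z0 e" for x
      using that e norm[of x] z0 by (auto simp: norm_divide subset_iff)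
  qed (use e in auto)
  then obtain c where c: "\<And>x. x \<in> ball z0 e \<Longrightarrow> f x / g x = c" by (auto simp: constant_on_def)
  then have "c = 1" using e z0 by force
  have "f x = g x" if "x \<in> ball z0 e" for x using c[OF that] \<open>c = 1\<close> e that by auto
  then show ?thesis
    using e z0 S f g \<open>z \<in> S\<close>
    by (intro analytic_continuation_open[of "ball z0 e" S f g z]) auto
qed

text \<open>The difference divided by \<open>2 * pi * \<i>\<close> is continuous with integer
  values, hence constant.\<close>

lemma exp_eq_imp_eq_on_connected:
  fixes f g :: "'a::topological_space \<Rightarrow> complex"
  assumes "connected S" "continuous_on S f" "continuous_on S g"
    and eq: "\<And>z. z \<in> S \<Longrightarrow> exp (f z) = exp (g z)" and "z0 \<in> S" "f z0 = g z0" and "z \<in> S"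
  shows "f z = g z"
proof -
  define d where "d x = (f x - g x) / (2 * of_real pi * \<i>)" for x
  have "continuous_on S d" unfolding d_def using assms by (intro continuous_intros) auto
  moreover have int: "d x \<in> \<int>" if x: "x \<in> S" for x
  proof -
    obtain n :: int where "f x = g x + of_int (2 * n) * pi * \<i>" using eq[OF x] exp_eq by metis
    then have "d x = of_int n" by (simp add: d_def)
    then show ?thesis by simp
  qed
  ultimately have "d constant_on S"
  proof (intro continuous_discrete_range_constant[OF \<open>connected S\<close>])
    fix x assume x: "x \<in> S"
    show "\<exists>e>0. \<forall>y. y \<in> S \<and> d y \<noteq> d x \<longrightarrow> e \<le> norm (d y - d x)"
    proof (intro exI[of _ 1] conjI allI impI)
      fix y assume "y \<in> S \<and> d y \<noteq> d x"
      then have "d y - d x \<in> \<int>" "d y - d x \<noteq> 0" using int x by auto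
      then obtain n :: int where n: "d y - d x = of_int n" by (metis Ints_cases)
      then have "n \<noteq> 0" using \<open>d y - d x \<noteq> 0\<close> by auto
      then show "1 \<le> norm (d y - d x)" unfolding n by simp
    qed simp
  qed
  then have "d z = d z0" using assms by (auto simp: constant_on_def)
  then show ?thesis using assms by (simp add: d_def)
qed

section \<open>The Briot--Bouquet expression\<close>

text \<open>Here \<open>a\<close> stands for \<open>\<alpha> / \<mu>\<close>, and
  \<open>exp (a * lq z)\<close> takes the place of a principal power of \<open>q z\<close>. The
  origin is excluded in \<open>pos2\<close> because the bare quotient there is 0 by the convention
  for division by zero, not the removable-singularity value.\<close>

locale BB_superordinate =
  fixes a \<beta> \<gamma> \<delta> :: complex and q lq :: "complex \<Rightarrow> complex"
  assumes q: "univalent q"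
    and lq: "lq holomorphic_on \<D>" "\<And>z. z \<in> \<D> \<Longrightarrow> exp (lq z) = q z"
    and den: "\<And>z. z \<in> \<D> \<Longrightarrow> \<beta> * q z + \<gamma> \<noteq> 0"
    and pos1: "\<And>z. z \<in> \<D> \<Longrightarrow> Re ((\<beta> * q z + \<gamma>) * (1 + a + a * \<delta> / q z)) > 0"
    and pos2: "\<And>z. z \<in> \<D> \<Longrightarrow> z \<noteq> 0 \<Longrightarrow>
      Re (a * (z * deriv q z / q z) + z * deriv (BB_quot \<beta> \<gamma> q) z / BB_quot \<beta> \<gamma> q z) > 0"
begin

lemma q_hol: "q holomorphic_on \<D>" and q_inj: "inj_on q \<D>"
  using q by (auto simp: univalent_def)

lemma q_nz: "z \<in> \<D> \<Longrightarrow> q z \<noteq> 0"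
  using lq(2) by (metis exp_not_eq_zero)

lemma dq_nz: "z \<in> \<D> \<Longrightarrow> deriv q z \<noteq> 0"
  by (rule holomorphic_injective_imp_regular[OF q_hol open_ball q_inj])

lemma dq: "z \<in> \<D> \<Longrightarrow> (q has_field_derivative deriv q z) (at z)"
  using q_hol by (simp add: holomorphic_derivI)

lemma dlq: "z \<in> \<D> \<Longrightarrow> (lq has_field_derivative deriv q z / q z) (at z)"
proof -
  assume z: "z \<in> \<D>"
  have l: "(lq has_field_derivative deriv lq z) (at z)" using lq z by (simp add: holomorphic_derivI)
  have "((\<lambda>z. exp (lq z)) has_field_derivative deriv lq z * q z) (at z)"
    using z by (auto intro!: derivative_eq_intros l simp: lq)
  then have "(q has_field_derivative deriv lq z * q z) (at z)"
    by (rule has_field_derivative_transform_within_open[OF _ open_ball z]) (simp add: lq)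
  then have "deriv q z = deriv lq z * q z" by (rule DERIV_imp_deriv)
  then show ?thesis using l q_nz[OF z] by simp
qed

text \<open>The factor \<open>z\<close> of \<open>BB_quot\<close> is removed so that
  \<open>R1\<close> has no zero at the origin. The function \<open>\<phi>\<close> of
  \<open>z\<close> below includes \<open>deriv q z\<close>, so that \<open>z * \<phi> z\<close> is
  the \<open>Q\<close> of the overview.\<close>

definition R1 where "R1 z = deriv q z / (\<beta> * q z + \<gamma>)"
definition \<phi> where "\<phi> z = exp (a * lq z) * R1 z"
definition h where "h z = exp (a * lq z) * (q z + \<delta>) + z * \<phi> z"

lemma R1_hol: "R1 holomorphic_on \<D>"
  unfolding R1_def using den q_hol by (intro holomorphic_intros holomorphic_deriv) auto

lemma R1_nz: "z \<in> \<D> \<Longrightarrow> R1 z \<noteq> 0"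
  using den dq_nz by (simp add: R1_def)

lemma dR1: "z \<in> \<D> \<Longrightarrow> (R1 has_field_derivative deriv R1 z) (at z)"
  using R1_hol by (simp add: holomorphic_derivI)

lemma \<phi>_hol: "\<phi> holomorphic_on \<D>"
  unfolding \<phi>_def by (intro holomorphic_intros R1_hol lq)

lemma \<phi>_nz: "z \<in> \<D> \<Longrightarrow> \<phi> z \<noteq> 0"
  using R1_nz by (simp add: \<phi>_def)

lemma dE: "z \<in> \<D> \<Longrightarrow> ((\<lambda>z. exp (a * lq z)) has_field_derivative exp (a * lq z) * (a * (deriv q z / q z))) (at z)"
  by (auto intro!: derivative_eq_intros dlq)

lemma d\<phi>: "z \<in> \<D> \<Longrightarrow> (\<phi> has_field_derivative \<phi> z * (a * (deriv q z / q z) + deriv R1 z / R1 z)) (at z)"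
  using DERIV_mult[OF dE dR1, of z] R1_nz[of z] unfolding \<phi>_def by (simp add: distrib_left mult_ac)

lemma log_deriv_\<phi>: "z \<in> \<D> \<Longrightarrow> deriv \<phi> z / \<phi> z = a * (deriv q z / q z) + deriv R1 z / R1 z"
  using DERIV_imp_deriv[OF d\<phi>] \<phi>_nz by simp

text \<open>Since \<open>z * \<phi> z\<close> is \<open>exp (a * lq z)\<close> times the
  Briot--Bouquet quotient, \<open>z\<close> times its logarithmic derivative is the sum in
  \<open>pos2\<close>. At the origin the expression equals 1.\<close>

lemma \<phi>_pos:
  assumes z: "z \<in> \<D>"
  shows "Re (1 + z * deriv \<phi> z / \<phi> z) > 0"
proof (cases "z = 0")
  case False
  have "BB_quot \<beta> \<gamma> q = (\<lambda>z. z * R1 z)" by (auto simp: BB_quot_def R1_def)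
  moreover have "((\<lambda>z. z * R1 z) has_field_derivative R1 z + z * deriv R1 z) (at z)"
    using z by (auto intro!: derivative_eq_intros dR1)
  then have "deriv (\<lambda>z. z * R1 z) z = R1 z + z * deriv R1 z" by (rule DERIV_imp_deriv)
  ultimately have "z * deriv (BB_quot \<beta> \<gamma> q) z / BB_quot \<beta> \<gamma> q z = 1 + z * (deriv R1 z / R1 z)"
    using False R1_nz[OF z] by (simp add: add_divide_distrib)
  then have "1 + z * (deriv \<phi> z / \<phi> z) =
      a * (z * deriv q z / q z) + z * deriv (BB_quot \<beta> \<gamma> q) z / BB_quot \<beta> \<gamma> q z"
    unfolding log_deriv_\<phi>[OF z] by (simp add: distrib_left mult_ac)
  then show ?thesis using pos2[OF z False] by simp
qed simp

lemma ex_convex_map: "\<exists>\<Phi>. convex_map \<Phi> \<phi>"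
proof -
  obtain \<Phi> where "\<And>z. z \<in> \<D> \<Longrightarrow> (\<Phi> has_field_derivative \<phi> z) (at z within \<D>)"
    using holomorphic_convex_primitive'[OF convex_ball open_ball \<phi>_hol] by metis
  then have "convex_map \<Phi> \<phi>"
    using \<phi>_hol \<phi>_nz \<phi>_pos by unfold_locales (auto simp: at_within_open[OF _ open_ball])
  then show ?thesis by blast
qed

text \<open>The derivative of \<open>h\<close> with \<open>\<phi>\<close> pulled out: the cofactor
  is the sum of the quantities controlled by \<open>pos1\<close> and
  \<open>\<phi>_pos\<close>.\<close>

definition h' where
  "h' z = \<phi> z * ((\<beta> * q z + \<gamma>) * (1 + a + a * \<delta> / q z) + (1 + z * deriv \<phi> z / \<phi> z))"

lemma dh:
  assumes z: "z \<in> \<D>"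
  shows "(h has_field_derivative h' z) (at z)"
proof -
  have "((\<lambda>z. exp (a * lq z) * (q z + \<delta>)) has_field_derivative
      exp (a * lq z) * (a * (deriv q z / q z)) * (q z + \<delta>) + deriv q z * exp (a * lq z)) (at z)"
    using z by (auto intro!: derivative_eq_intros dq dE[THEN DERIV_cong])
  moreover have "((\<lambda>z. z * \<phi> z) has_field_derivative \<phi> z + z * deriv \<phi> z) (at z)"
    using z \<phi>_hol by (auto intro!: derivative_eq_intros holomorphic_derivI)
  ultimately have "(h has_field_derivative exp (a * lq z) * (a * (deriv q z / q z)) * (q z + \<delta>) +
      deriv q z * exp (a * lq z) + (\<phi> z + z * deriv \<phi> z)) (at z)"
    unfolding h_def by (rule DERIV_add)
  moreover have "exp (a * lq z) * (a * (deriv q z / q z)) * (q z + \<delta>) + deriv q z * exp (a * lq z) =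
      \<phi> z * ((\<beta> * q z + \<gamma>) * (1 + a + a * \<delta> / q z))"
  proof -
    \<comment> \<open>Cancelling the denominator of \<open>R1\<close> is what produces the factor
      \<open>\<beta> * q z + \<gamma>\<close> of the first positivity condition.\<close>
    have "\<phi> z * (\<beta> * q z + \<gamma>) = exp (a * lq z) * deriv q z" using den[OF z] by (simp add: \<phi>_def R1_def)
    then have "\<phi> z * ((\<beta> * q z + \<gamma>) * (1 + a + a * \<delta> / q z)) = exp (a * lq z) * deriv q z * (1 + a + a * \<delta> / q z)"
      by (simp only: mult.assoc[symmetric])
    also have "\<dots> = exp (a * lq z) * (a * (deriv q z / q z)) * (q z + \<delta>) + deriv q z * exp (a * lq z)"
      using q_nz[OF z] by (simp add: field_simps)
    finally show ?thesis by simp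
  qed
  moreover have "\<phi> z + z * deriv \<phi> z = \<phi> z * (1 + z * deriv \<phi> z / \<phi> z)"
    using \<phi>_nz[OF z] by (simp add: distrib_left)
  ultimately show ?thesis unfolding h'_def by (simp only: distrib_left)
qed

lemma h'_pos: "z \<in> \<D> \<Longrightarrow> Re (h' z / \<phi> z) > 0"
  using pos1[of z] \<phi>_pos[of z] \<phi>_nz[of z] by (simp add: h'_def)

lemma h_ray:
  assumes "norm z < norm \<zeta>" "\<zeta> \<in> \<D>" "0 \<le> t"
  shows "h z \<noteq> h \<zeta> + of_real t * (\<zeta> * \<phi> \<zeta>)"
proof -
  obtain \<Phi> where "convex_map \<Phi> \<phi>" using ex_convex_map ..
  then interpret convex_map \<Phi> \<phi> .
  show ?thesis using close_to_convex_ray[OF dh h'_pos assms] .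
qed

lemma h_eq: "h z = exp (a * lq z) * (q z + \<delta> + BB_quot \<beta> \<gamma> q z)"
  by (simp add: h_def \<phi>_def R1_def BB_quot_def distrib_left mult_ac)

lemma subordinate_if:
  assumes p: "p holomorphic_on \<D>" "p 0 = q 0"
    and lp: "lp holomorphic_on \<D>" "\<And>z. z \<in> \<D> \<Longrightarrow> exp (lp z) = p z" "lp 0 = lq 0"
    and w: "w holomorphic_on \<D>" "w ` \<D> \<subseteq> \<D>" "w 0 = 0"
    and eq: "\<And>z. z \<in> \<D> \<Longrightarrow> exp (a * lp z) * (p z + \<delta> + BB_quot \<beta> \<gamma> p z) = h (w z)"
  shows "p \<prec> q"
proof (rule ccontr)
  assume "\<not> p \<prec> q"
  then obtain z0 \<zeta>0 m v where *: "norm z0 < norm \<zeta>0" "\<zeta>0 \<in> \<D>" "(1::real) \<le> m"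
    "p z0 = q \<zeta>0" "z0 * deriv p z0 = of_real m * (\<zeta>0 * deriv q \<zeta>0)"
    "continuous_on (cball 0 (norm z0)) v" "v 0 = 0" "v z0 = \<zeta>0"
    "\<And>z. z \<in> cball 0 (norm z0) \<Longrightarrow> v z \<in> \<D> \<and> p z = q (v z)"
    using not_subordinate_first_exit[OF q p] by metis
  have z0: "z0 \<in> \<D>" "cball 0 (norm z0) \<subseteq> \<D>" using *(1,2) by auto
  \<comment> \<open>Equality of \<open>p z0\<close> and \<open>q \<zeta>0\<close> does not by itself
    identify their logarithms. Both sides agree at 0 and are followed through \<open>v\<close> on
    the connected closed disc.\<close>
  have "lp z0 = lq (v z0)"
  proof (rule exp_eq_imp_eq_on_connected[of "cball 0 (norm z0)" lp "\<lambda>z. lq (v z)" 0])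
    show "continuous_on (cball 0 (norm z0)) lp"
      using lp(1) z0(2) by (meson holomorphic_on_imp_continuous_on continuous_on_subset)
    show "continuous_on (cball 0 (norm z0)) (\<lambda>z. lq (v z))"
      using *(9) by (intro continuous_on_compose2[OF holomorphic_on_imp_continuous_on[OF lq(1)] *(6)]) auto
    show "exp (lp z) = exp (lq (v z))" if "z \<in> cball 0 (norm z0)" for z
      using *(9)[OF that] lp(2) lq(2) that z0(2) by (metis subsetD)
  qed (use lp(3) * in auto)
  then have l: "lp z0 = lq \<zeta>0" using * by simp
  have "BB_quot \<beta> \<gamma> p z0 = of_real m * (\<zeta>0 * R1 \<zeta>0)"
    using *(4,5) by (simp add: BB_quot_def R1_def)
  \<comment> \<open>The excess over \<open>h \<zeta>0\<close> comes from the Briot--Bouquet term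
    alone, which is multiplied by \<open>m\<close>.\<close>
  then have "h (w z0) = h \<zeta>0 + of_real (m - 1) * (\<zeta>0 * \<phi> \<zeta>0)"
    using eq[OF z0(1)] *(4) by (simp add: l h_def \<phi>_def algebra_simps)
  moreover have "norm (w z0) \<le> norm z0"
    using w(2) z0 by (intro Schwarz_Lemma(1)[OF w(1,3)]) (auto simp: image_subset_iff)
  ultimately show False using h_ray[of "w z0" \<zeta>0 "m - 1"] * by auto
qed

end

section \<open>A holomorphic root of the expression for members of the class\<close>

text \<open>
  For \<open>a = \<alpha> / \<mu>\<close> and a logarithm \<open>lp\<close> of \<open>p\<close> this is a branch of \<open>BB_expr\<close> to the power \<open>1 / \<mu>\<close> that
  stays holomorphic where the second factor vanishes.
\<close>

definition BB_root ::
  "complex \<Rightarrow> complex \<Rightarrow> complex \<Rightarrow> complex \<Rightarrow> (complex \<Rightarrow> complex) \<Rightarrow> (complex \<Rightarrow> complex) \<Rightarrow> complex \<Rightarrow> complex"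
where
  "BB_root a \<beta> \<gamma> \<delta> p lp z = exp (a * lp z) * (p z + \<delta> + BB_quot \<beta> \<gamma> p z)"

context
  fixes \<alpha> \<mu> :: real and \<beta> \<gamma> \<delta> :: complex and p :: "complex \<Rightarrow> complex"
  assumes \<mu>: "0 < \<mu>" and p: "p \<in> class_R \<alpha> \<beta> \<gamma> \<delta> \<mu>"
begin

lemma class_R_D:
  "p holomorphic_on \<D>" "p 0 = 1" "z \<in> \<D> \<Longrightarrow> p z \<noteq> 0" "z \<in> \<D> \<Longrightarrow> \<beta> * p z + \<gamma> \<noteq> 0"
  "(\<lambda>z. p z powr of_real \<alpha>) holomorphic_on \<D>"
  "(\<lambda>z. (p z + \<delta> + BB_quot \<beta> \<gamma> p z) powr of_real \<mu>) holomorphic_on \<D>"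
  using p by (auto simp: class_R_def)

lemma BB_quot_holomorphic: "BB_quot \<beta> \<gamma> p holomorphic_on \<D>"
  unfolding BB_quot_def using class_R_D by (intro holomorphic_intros holomorphic_deriv) auto

lemma ex_log_class_R:
  obtains lp where "lp holomorphic_on \<D>" "\<And>z. z \<in> \<D> \<Longrightarrow> exp (lp z) = p z" "lp 0 = 0"
proof -
  obtain g where g: "g holomorphic_on \<D>" "\<And>z. z \<in> \<D> \<Longrightarrow> exp (g z) = p z"
    using holomorphic_logarithm_exists[of \<D> p 0] class_R_D(1,3)
    by (metis centre_in_ball convex_ball open_ball zero_less_one)
  have "exp (g 0) = 1" using g(2)[of 0] class_R_D(2) by simp
  show thesis
  proof
    show "(\<lambda>z. g z - g 0) holomorphic_on \<D>" using g by (intro holomorphic_intros)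
    show "exp (g z - g 0) = p z" if "z \<in> \<D>" for z
      using g(2)[OF that] \<open>exp (g 0) = 1\<close> by (simp add: exp_diff)
  qed simp
qed

context
  fixes lp :: "complex \<Rightarrow> complex"
  assumes lp: "lp holomorphic_on \<D>" "\<And>z. z \<in> \<D> \<Longrightarrow> exp (lp z) = p z" "lp 0 = 0"
begin

text \<open>The principal power is holomorphic by membership in the class; both sides have modulus
  \<open>norm (p z) powr \<alpha>\<close> and the value 1 at the origin.\<close>

lemma powr_class_R:
  assumes "z \<in> \<D>"
  shows "p z powr of_real \<alpha> = exp (of_real \<alpha> * lp z)"
proof (rule holomorphic_eq_if_norm_eq[OF class_R_D(5), where ?z0.0 = 0])
  show "(\<lambda>z. exp (of_real \<alpha> * lp z)) holomorphic_on \<D>" by (intro holomorphic_intros lp)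
  show "norm (p z powr of_real \<alpha>) = norm (exp (of_real \<alpha> * lp z))" if "z \<in> \<D>" for z
  proof -
    have "norm (p z) = exp (Re (lp z))" using lp(2)[OF that] by (metis norm_exp_eq_Re)
    then show ?thesis using class_R_D(3)[OF that] by (simp add: norm_powr_real_powr' powr_def)
  qed
qed (use assms lp class_R_D in auto)

abbreviation root where
  "root \<equiv> BB_root (of_real (\<alpha> / \<mu>)) \<beta> \<gamma> \<delta> p lp"

text \<open>Moduli do not depend on the branch, and the relation persists at zeros of the second
  factor, where both sides vanish.\<close>

lemma norm_BB_root:
  assumes "z \<in> \<D>"
  shows "norm (BB_expr \<alpha> \<beta> \<gamma> \<delta> \<mu> p z) = norm (root z) powr \<mu>"
proof -
  have "norm (exp (of_real \<alpha> * lp z)) = norm (exp (of_real (\<alpha> / \<mu>) * lp z)) powr \<mu>"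
    using \<mu> by (simp add: powr_def)
  then show ?thesis
    using powr_class_R[OF assms] by (simp add: BB_expr_def BB_root_def norm_mult norm_powr_real_powr' powr_mult)
qed

lemma BB_root_eq_BB_expr:
  assumes "z \<in> \<D>" "\<mu> = 1"
  shows "root z = BB_expr \<alpha> \<beta> \<gamma> \<delta> \<mu> p z"
proof -
  have "x powr 1 = x" for x :: complex by (simp add: powr_def)
  then show ?thesis using powr_class_R[OF assms(1)] assms by (simp add: BB_expr_def BB_root_def)
qed

lemma BB_root_holomorphic: "root holomorphic_on \<D>"
  unfolding BB_root_def by (intro holomorphic_intros lp class_R_D BB_quot_holomorphic)

lemma BB_root_0: "root 0 = 1 + \<delta>"
  using lp(3) class_R_D(2) by (simp add: BB_root_def BB_quot_def)

text \<open>A simple zero of \<open>root\<close> would make the holomorphic function \<open>BB_expr\<close> of order \<open>\<mu> < 1\<close>.\<close>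

lemma BB_root_nonzero_at_0:
  assumes "\<mu> < 1" and d: "deriv root 0 \<noteq> 0"
  shows "1 + \<delta> \<noteq> 0"
proof
  assume 0: "1 + \<delta> = 0"
  let ?C = "BB_expr \<alpha> \<beta> \<gamma> \<delta> \<mu> p"
  \<comment> \<open>Both functions vanish at the origin, so a factor \<open>z\<close> splits off
    from each, leaving \<open>H\<close> and \<open>K\<close>.\<close>
  have "root 0 = 0" using BB_root_0 0 by simp
  then obtain H where H: "H holomorphic_on \<D>" "\<And>z. norm z < 1 \<Longrightarrow> root z = z * H z" "deriv root 0 = H 0"
    using Schwarz3[OF BB_root_holomorphic] by blast
  have "?C holomorphic_on \<D>" unfolding BB_expr_def by (intro holomorphic_intros class_R_D)
  moreover have "?C 0 = 0" using norm_BB_root[of 0] BB_root_0 0 by simp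
  ultimately obtain K where K: "K holomorphic_on \<D>" "\<And>z. norm z < 1 \<Longrightarrow> ?C z = z * K z"
    using Schwarz3 by metis
  have isc: "isCont H 0" "isCont K 0"
    using H K by (auto intro!: continuous_on_interior[of \<D>] holomorphic_on_imp_continuous_on)
  have lim0: "((\<lambda>t::real. complex_of_real t) \<longlongrightarrow> 0) (at_right 0)"
    by (intro tendsto_eq_intros) auto
  have lim1: "((\<lambda>t. norm (H (of_real t)) powr \<mu>) \<longlongrightarrow> norm (H 0) powr \<mu>) (at_right 0)"
    using d H(3) by (intro tendsto_intros isCont_tendsto_compose[OF isc(1) lim0]) auto
  have lim2: "((\<lambda>t. t powr (1 - \<mu>) * norm (K (of_real t))) \<longlongrightarrow> 0 * norm (K 0)) (at_right 0)"
    using \<open>\<mu> < 1\<close> by (intro tendsto_intros isCont_tendsto_compose[OF isc(2) lim0] tendsto_zero_powrI[where b = "1 - \<mu>"])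
      (auto simp: eventually_at_right_less intro: eventually_mono[OF eventually_at_right_less])
  \<comment> \<open>Comparing moduli at small \<open>t > 0\<close> and dividing by
    \<open>t powr \<mu>\<close> leaves the positive power \<open>1 - \<mu>\<close> of
    \<open>t\<close> beside \<open>K\<close>. The left side tends to 0, which forces
    \<open>H 0 = 0\<close>.\<close>
  have "\<forall>\<^sub>F t in at_right 0. t powr (1 - \<mu>) * norm (K (of_real t)) = norm (H (of_real t)) powr \<mu>"
  proof -
    have "t powr (1 - \<mu>) * norm (K (of_real t)) = norm (H (of_real t)) powr \<mu>" if "0 < t" "t < 1" for t
    proof -
      have "t * norm (K (of_real t)) = t powr \<mu> * norm (H (of_real t)) powr \<mu>"
        using norm_BB_root[of "of_real t"] K(2)[of "of_real t"] H(2)[of "of_real t"] that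
        by (simp add: norm_mult powr_mult)
      then show ?thesis using that by (simp add: powr_diff field_simps)
    qed
    then show ?thesis using eventually_at_right_real[of 0 "1::real"] by (auto elim: eventually_mono)
  qed
  from tendsto_unique[OF trivial_limit_at_right_real lim1 Lim_transform_eventually[OF lim2 this]]
  have "norm (H 0) powr \<mu> = 0" by simp
  then show False using d H(3) by simp
qed

end
end

section \<open>Transfer from the root to the principal powers, and the best dominant\<close>

theorem theorem2p2:
  fixes \<alpha> \<mu> :: real and \<beta> \<gamma> \<delta> :: complex and q R :: "complex \<Rightarrow> complex"
  assumes "0 < \<mu>" and "\<mu> \<le> 1" and "\<alpha> + \<mu> \<ge> 0" and "\<beta> \<noteq> 0"
    and "q \<in> class_R \<alpha> \<beta> \<gamma> \<delta> \<mu>" and "univalent q"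
    and R_def: "R = BB_quot \<beta> \<gamma> q"
    and "\<And>z. z \<in> \<D> \<Longrightarrow>
           Re ((\<beta> * q z + \<gamma>) *
             (1 + of_real \<alpha> / of_real \<mu> + of_real \<alpha> * \<delta> / (of_real \<mu> * q z))) > 0"
    and "\<And>z. z \<in> \<D> \<Longrightarrow>
           Re (of_real \<alpha> / of_real \<mu> * (z * deriv q z / q z) + log_deriv_quot R z) > 0"
  shows "(\<forall>p \<in> class_R \<alpha> \<beta> \<gamma> \<delta> \<mu>.
            BB_expr \<alpha> \<beta> \<gamma> \<delta> \<mu> p \<prec> BB_expr \<alpha> \<beta> \<gamma> \<delta> \<mu> q \<longrightarrow> p \<prec> q) \<and>
         best_dominant \<alpha> \<beta> \<gamma> \<delta> \<mu> (BB_expr \<alpha> \<beta> \<gamma> \<delta> \<mu> q) q"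
proof -
  note \<mu> = assms(1) and qR = assms(5)
  obtain lq where lqR: "lq holomorphic_on \<D>" "\<And>z. z \<in> \<D> \<Longrightarrow> exp (lq z) = q z" "lq 0 = 0"
    using ex_log_class_R[OF \<mu> qR] by metis
  interpret BB_superordinate "of_real (\<alpha> / \<mu>)" \<beta> \<gamma> \<delta> q lq
  proof
    show "Re (of_real (\<alpha> / \<mu>) * (z * deriv q z / q z) + z * deriv (BB_quot \<beta> \<gamma> q) z / BB_quot \<beta> \<gamma> q z) > 0"
      if "z \<in> \<D>" "z \<noteq> 0" for z
      using assms(9)[OF that(1)] that(2) by (simp add: log_deriv_quot_def R_def)
  qed (use assms(6,8) lqR class_R_D[OF \<mu> qR] in auto)
  have root_q: "BB_root (of_real (\<alpha> / \<mu>)) \<beta> \<gamma> \<delta> q lq = h"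
    by (rule ext) (simp only: h_eq BB_root_def)
  have main: "p \<prec> q"
    if p: "p \<in> class_R \<alpha> \<beta> \<gamma> \<delta> \<mu>" and sub: "BB_expr \<alpha> \<beta> \<gamma> \<delta> \<mu> p \<prec> BB_expr \<alpha> \<beta> \<gamma> \<delta> \<mu> q" for p
  proof -
    obtain lp where lp: "lp holomorphic_on \<D>" "\<And>z. z \<in> \<D> \<Longrightarrow> exp (lp z) = p z" "lp 0 = 0"
      using ex_log_class_R[OF \<mu> p] by metis
    obtain w where w: "w holomorphic_on \<D>" "w ` \<D> \<subseteq> \<D>" "w 0 = 0"
      and eq: "\<And>z. z \<in> \<D> \<Longrightarrow> BB_expr \<alpha> \<beta> \<gamma> \<delta> \<mu> p z = BB_expr \<alpha> \<beta> \<gamma> \<delta> \<mu> q (w z)"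
      using sub unfolding subordinate_def by metis
    have wD: "w z \<in> \<D>" if "z \<in> \<D>" for z using w(2) that by blast
    define X where "X = BB_root (of_real (\<alpha> / \<mu>)) \<beta> \<gamma> \<delta> p lp"
    have "X z = h (w z)" if z: "z \<in> \<D>" for z
    \<comment> \<open>For \<open>\<mu> = 1\<close> the root is the expression itself. Otherwise the
      two roots are compared through their moduli, which requires their common value
      \<open>1 + \<delta>\<close> at the origin to be nonzero.\<close>
    proof (cases "\<mu> = 1")
      case True
      then show ?thesis
        using eq[OF z] BB_root_eq_BB_expr[OF \<mu> p lp z] BB_root_eq_BB_expr[OF \<mu> qR lqR wD[OF z]]
        unfolding X_def root_q by simp
    next
      case False
      \<comment> \<open>A zero of \<open>h\<close> at the origin would be simple, which holomorphy
        of the principal power rules out for \<open>\<mu> < 1\<close>.\<close>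
      have "deriv h 0 \<noteq> 0" using DERIV_imp_deriv[OF dh, of 0] h'_pos[of 0] by auto
      then have nz: "1 + \<delta> \<noteq> 0"
        using BB_root_nonzero_at_0[OF \<mu> qR lqR] False assms(2) unfolding root_q by simp
      show ?thesis
      proof (rule holomorphic_eq_if_norm_eq[where S = \<D> and f = X and g = "\<lambda>z. h (w z)" and ?z0.0 = 0])
        show "X holomorphic_on \<D>" unfolding X_def by (rule BB_root_holomorphic[OF \<mu> p lp])
        have "h holomorphic_on \<D>" using BB_root_holomorphic[OF \<mu> qR lqR] unfolding root_q by simp
        then have "(h \<circ> w) holomorphic_on \<D>" using w(1,2) by (intro holomorphic_on_compose_gen)
        then show "(\<lambda>z. h (w z)) holomorphic_on \<D>" by (simp add: o_def)
        show "norm (X z) = norm (h (w z))" if "z \<in> \<D>" for z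
        proof -
          have "norm (X z) powr \<mu> = norm (h (w z)) powr \<mu>"
            using norm_BB_root[OF \<mu> p lp that] norm_BB_root[OF \<mu> qR lqR wD[OF that]] eq[OF that]
            unfolding X_def root_q by simp
          then have "(norm (X z) powr \<mu>) powr (1 / \<mu>) = (norm (h (w z)) powr \<mu>) powr (1 / \<mu>)" by simp
          then show ?thesis using \<mu> by (simp add: powr_powr)
        qed
        show "X 0 = h (w 0)" "h (w 0) \<noteq> 0"
          using nz BB_root_0[OF \<mu> p lp] BB_root_0[OF \<mu> qR lqR] w(3) unfolding X_def root_q by simp_all
      qed (use z in auto)
    qed
    then show ?thesis
      using class_R_D[OF \<mu> p] class_R_D[OF \<mu> qR] lp lqR w
      by (intro subordinate_if[of p lp w]) (auto simp: X_def BB_root_def)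
  qed
  \<comment> \<open>Reflexivity makes \<open>q\<close> itself a solution, so applying any other
    dominant to \<open>q\<close> shows that \<open>q\<close> is best.\<close>
  have "f \<prec> f" for f :: "complex \<Rightarrow> complex"
    unfolding subordinate_def by (rule exI[of _ "\<lambda>z. z"]) auto
  then show ?thesis using main qR assms(6) by (auto simp: best_dominant_def dominant_def)
qed

end
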